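(* Let $k\ge 0$ and $n$ be integers with $n\ge 4k+3$. Then $$PF(n,n-k)-PF(n-2,n-k-2)=p(k),$$ where $p(k)$ is the number of partitions of $k$.
   Context: A partition $\lambda=(\lambda_1\ge\cdots\ge\lambda_\ell)$ of $n$ is a finite nonincreasing sequence of positive integers with sum $n$; $\ell(\lambda)$ is its number of parts; $p(0)=1$. The hook length $h_{(i,j)}(\lambda)$ of a cell $(i,j)$ of the Ferrers diagram is the number of cells consisting of the cell itself, the cells to its right in its row and the cells below it in its column. A numerical set is a subset $S\subseteq\mathbb{N}_0$ containing $0$ with finite complement; a numerical semigroup is a numerical set closed under addition. For a partition $\lambda$ let $S_\lambda=\mathbb{N}_0\setminus\{h_{(i,1)}(\lambda):1\le i\le\ell(\lambda)\}$. $PF(n,f)$ is the number of partitions $\lambda$ of $n$ with largest hook length $h_{(1,1)}(\lambda)=f$ such that $S_\lambda$ is a numerical semigroup. *)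

theory Defs
  imports Main
begin

definition is_partition :: "nat list \<Rightarrow> nat \<Rightarrow> bool" where
  "is_partition l n \<longleftrightarrow> sorted_wrt (\<ge>) l \<and> (\<forall>x\<in>set l. 0 < x) \<and> sum_list l = n"

definition num_partitions :: "nat \<Rightarrow> nat" where
  "num_partitions n = card {l. is_partition l n}"

(* Rows and columns are numbered from 1, whereas list positions start at 0. *)
definition ferrers :: "nat list \<Rightarrow> (nat \<times> nat) set" where
  "ferrers l = {(i, j). 1 \<le> i \<and> i \<le> length l \<and> 1 \<le> j \<and> j \<le> l ! (i - 1)}"

definition hook_length :: "nat list \<Rightarrow> nat \<Rightarrow> nat \<Rightarrow> nat" where
  "hook_length l i j =
     card {(i', j') \<in> ferrers l. (i' = i \<and> j \<le> j') \<or> (j' = j \<and> i \<le> i')}"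

definition numerical_set :: "nat set \<Rightarrow> bool" where
  "numerical_set S \<longleftrightarrow> 0 \<in> S \<and> finite (- S)"

definition numerical_semigroup :: "nat set \<Rightarrow> bool" where
  "numerical_semigroup S \<longleftrightarrow> numerical_set S \<and> (\<forall>x\<in>S. \<forall>y\<in>S. x + y \<in> S)"

definition partition_set :: "nat list \<Rightarrow> nat set" where
  "partition_set l = - {hook_length l i 1 | i. 1 \<le> i \<and> i \<le> length l}"

definition PF :: "nat \<Rightarrow> nat \<Rightarrow> nat" where
  "PF n f = card {l. is_partition l n \<and> hook_length l 1 1 = f
                     \<and> numerical_semigroup (partition_set l)}"

(* The sets counted above are finite, so that the cardinalities are genuine counts. *)
lemma finite_partitions: "finite {l. is_partition l n}"
proof (rule finite_subset)
  have "length l \<le> sum_list l" if "\<forall>x\<in>set l. 0 < x" for l :: "nat list"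
    using that by (induction l) auto
  moreover have "set l \<subseteq> {..sum_list l}" for l :: "nat list"
    using member_le_sum_list by auto
  ultimately show "{l. is_partition l n} \<subseteq> {l. set l \<subseteq> {..n} \<and> length l \<le> n}"
    by (fastforce simp: is_partition_def)
  show "finite {l. set l \<subseteq> {..n} \<and> length l \<le> n}"
    by (rule finite_lists_length_le) simp
qed

end

theory Submission
  imports Defs
begin

text \<open>
  Deleting the first row and column of a partition of \<open>n\<close> with largest hook \<open>f = n - k\<close>
  leaves a partition \<open>\<mu>\<close> of \<open>k\<close>, so the partition is determined by \<open>\<mu>\<close> and the number
  \<open>r\<close> of its parts equal to \<open>1\<close> below the first row; its gaps are \<open>f\<close>, the interval \<open>1, \<dots>, r\<close>
  and a copy, translated by \<open>r\<close>, of a set that depends on \<open>\<mu>\<close> only. If \<open>f > 3 k\<close>, the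
  complement is a semigroup as soon as \<open>f\<close> itself is not a sum of two non-gaps: a smaller gap
  that is such a sum forces a non-gap \<open>s\<close> so small that \<open>f - s\<close> lies beyond all other gaps.
  The latter condition is invariant under \<open>(r, f) \<mapsto> (r + 1, f + 2)\<close>. Hence the pairs
  \<open>(\<mu>, r)\<close> for \<open>f - 2\<close> embed into those for \<open>f\<close>, and the ones missed are
  exactly those with the largest possible \<open>r\<close>, one for each \<open>\<mu>\<close>.
\<close>

section \<open>First-column hook lengths\<close>

text \<open>First-column hooks of a partition. A hook reaches only right and down, so a row put on
  top leaves the hooks below it unchanged.\<close>

fun hook_set :: "nat list \<Rightarrow> nat set" where
  "hook_set [] = {}"
| "hook_set (x # xs) = insert (x + length xs) (hook_set xs)"

lemma hook_set_conv_nth: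
  "hook_set l = (\<lambda>i. l ! (i - 1) + (length l - i)) ` {1..length l}"
proof (induction l)
  case (Cons x xs)
  have "{1..length (x # xs)} = insert 1 (Suc ` {1..length xs})"
    by (auto simp: image_Suc_atLeastAtMost)
  then have "(\<lambda>i. (x # xs) ! (i - 1) + (length (x # xs) - i)) ` {1..length (x # xs)}
      = insert (x + length xs) ((\<lambda>i. (x # xs) ! i + (length xs - i)) ` {1..length xs})"
    by (simp only: image_insert image_image) simp
  also have "(\<lambda>i. (x # xs) ! i + (length xs - i)) ` {1..length xs} = hook_set xs"
    unfolding Cons.IH by (intro image_cong) (auto simp: nth_Cons')
  finally show ?case by simp
qed simp

lemma hook_length_first_column:
  assumes pos: "\<forall>x\<in>set l. 0 < x" and i: "1 \<le> i" "i \<le> length l"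
  shows "hook_length l i 1 = l ! (i - 1) + (length l - i)"
proof -
  have nth: "0 < l ! (j - 1)" if "1 \<le> j" "j \<le> length l" for j
    using pos that by simp
  have "{(i', j') \<in> ferrers l. (i' = i \<and> 1 \<le> j') \<or> (j' = 1 \<and> i \<le> i')}
      = {i} \<times> {1..l ! (i - 1)} \<union> {Suc i..length l} \<times> {1}"
    using i nth by (force simp: ferrers_def Suc_le_eq)
  moreover have "card ({i} \<times> {1..l ! (i - 1)} \<union> {Suc i..length l} \<times> {1})
      = card ({i} \<times> {1..l ! (i - 1)}) + card ({Suc i..length l} \<times> {1::nat})"
    by (rule card_Un_disjoint) auto
  ultimately show ?thesis
    unfolding hook_length_def by (simp add: card_cartesian_product)
qed

lemma partition_set_conv_hook_set:
  assumes "\<forall>x\<in>set l. 0 < x"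
  shows "partition_set l = - hook_set l"
proof -
  have "{hook_length l i 1 | i. 1 \<le> i \<and> i \<le> length l} = (\<lambda>i. hook_length l i 1) ` {1..length l}"
    by auto
  also have "\<dots> = hook_set l"
    unfolding hook_set_conv_nth
    by (intro image_cong refl hook_length_first_column[OF assms]) auto
  finally show ?thesis by (simp add: partition_set_def)
qed

lemma hook_length_Cons:
  assumes "\<forall>y\<in>set (x # xs). 0 < y"
  shows "hook_length (x # xs) 1 1 = x + length xs"
  using hook_length_first_column[OF assms, of 1] by simp

text \<open>The \<open>r\<close> bottom rows of length 1 have hooks 1 to \<open>r\<close> and
  lengthen every first-column hook above them by \<open>r\<close>.\<close>

lemma hook_set_append_replicate:
  "hook_set (xs @ replicate r 1) = {1..r} \<union> (\<lambda>x. r + x) ` hook_set xs"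
proof (induction xs)
  case Nil
  show ?case by (induction r) (simp_all add: atLeastAtMostSuc_conv)
qed (simp add: ac_simps)

text \<open>For nonincreasing \<open>\<mu>\<close> this is the largest element of
  \<open>hook_set (map Suc \<mu>)\<close>, or 0 if that set is empty.\<close>

definition corner :: "nat list \<Rightarrow> nat" where
  "corner \<mu> = (case \<mu> of [] \<Rightarrow> 0 | x # _ \<Rightarrow> x + length \<mu>)"

lemma hook_set_subset:
  assumes "sorted_wrt (\<ge>) \<mu>"
  shows "hook_set (map Suc \<mu>) \<subseteq> {1..corner \<mu>}"
  using assms
proof (induction \<mu>)
  case (Cons x xs)
  have "corner xs \<le> corner (x # xs)"
    using Cons.prems by (cases xs) (auto simp: corner_def)
  with Cons show ?case by (fastforce simp: corner_def)
qed simp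

lemma corner_le:
  assumes "is_partition \<mu> k"
  shows "corner \<mu> \<le> k + 1"
proof (cases \<mu>)
  case (Cons x xs)
  have "length xs \<le> sum_list xs" if "\<forall>x\<in>set xs. 0 < x" for xs :: "nat list"
    using that by (induction xs) auto
  with assms Cons show ?thesis by (fastforce simp: is_partition_def corner_def)
qed (simp add: corner_def)

section \<open>Gap sets\<close>

text \<open>First-column hooks when \<open>f\<close> is the hook of the top row and the rows below
  it are \<open>map Suc \<mu> @ replicate r 1\<close>.\<close>

definition gaps :: "nat list \<Rightarrow> nat \<Rightarrow> nat \<Rightarrow> nat set" where
  "gaps \<mu> r f = insert f ({1..r} \<union> (\<lambda>x. r + x) ` hook_set (map Suc \<mu>))"

definition frobenius_pair_free :: "nat list \<Rightarrow> nat \<Rightarrow> nat \<Rightarrow> bool" where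
  "frobenius_pair_free \<mu> r f \<longleftrightarrow> (\<forall>s t. s + t = f \<longrightarrow> s \<in> gaps \<mu> r f \<or> t \<in> gaps \<mu> r f)"

lemma gaps_le:
  assumes "is_partition \<mu> k" "x \<in> gaps \<mu> r f" "x \<noteq> f"
  shows "x \<le> r + corner \<mu>"
  using assms hook_set_subset[of \<mu>] by (fastforce simp: gaps_def is_partition_def)

lemma notin_gaps_gt:
  assumes "x \<notin> gaps \<mu> r f" "0 < x"
  shows "r < x"
  using assms by (auto simp: gaps_def)

lemma numerical_semigroup_iff_frobenius_pair_free:
  assumes part: "is_partition \<mu> k" and f: "3 * k < f" and r: "r + corner \<mu> < f"
  shows "numerical_semigroup (- gaps \<mu> r f) \<longleftrightarrow> frobenius_pair_free \<mu> r f"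
proof
  assume "numerical_semigroup (- gaps \<mu> r f)"
  then show "frobenius_pair_free \<mu> r f"
    unfolding numerical_semigroup_def frobenius_pair_free_def
    by (metis Compl_iff gaps_def insertI1)
next
  assume free: "frobenius_pair_free \<mu> r f"
  have H: "hook_set (map Suc \<mu>) \<subseteq> {1..corner \<mu>}"
    using part hook_set_subset by (simp add: is_partition_def)
  have fin: "finite (gaps \<mu> r f)"
    using finite_subset[OF H] by (simp add: gaps_def)
  have zero: "0 \<notin> gaps \<mu> r f"
    using f H by (auto simp: gaps_def)
  have closed: "s + t \<notin> gaps \<mu> r f"
    if s: "s \<notin> gaps \<mu> r f" and t: "t \<notin> gaps \<mu> r f" and le: "s \<le> t" for s t
  proof
    assume g: "s + t \<in> gaps \<mu> r f"
    have "s + t \<noteq> f"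
      using free s t by (auto simp: frobenius_pair_free_def)
    then have st: "s + t \<le> r + corner \<mu>"
      using gaps_le[OF part g] by simp
    have "0 < s"
      using g t by (cases s) auto
    then have "r < s"
      using notin_gaps_gt[OF s] by simp
    \<comment> \<open>From \<open>r < s\<close> and \<open>2 * s \<le> r + corner \<mu>\<close>
      follows \<open>s < corner \<mu>\<close>, so \<open>s \<le> k\<close>; then
      \<open>r + corner \<mu> + s \<le> 2 * s + k \<le> 3 * k < f\<close>.\<close>
    then have "r + corner \<mu> < f - s"
      using st le corner_le[OF part] f by linarith
    moreover have "f - s \<noteq> f"
      using \<open>0 < s\<close> f by linarith
    ultimately have "f - s \<notin> gaps \<mu> r f"
      using gaps_le[OF part] by fastforce
    moreover have "s + (f - s) = f"
      using st r by linarith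
    ultimately show False
      using free s unfolding frobenius_pair_free_def by blast
  qed
  have "s + t \<notin> gaps \<mu> r f" if "s \<notin> gaps \<mu> r f" "t \<notin> gaps \<mu> r f" for s t
    using closed[of s t] closed[of t s] that by (metis add.commute linear)
  with fin zero show "numerical_semigroup (- gaps \<mu> r f)"
    by (simp add: numerical_semigroup_def numerical_set_def)
qed

text \<open>The part of the gap set governed by \<open>r\<close> moves up by 1 and gains the gap 1.
  The bounds on \<open>x\<close> keep away from this new gap and from \<open>f\<close>, which moves
  by 2.\<close>

lemma Suc_in_gaps_Suc_iff:
  assumes "0 < x" "x < f"
  shows "Suc x \<in> gaps \<mu> (Suc r) (f + 2) \<longleftrightarrow> x \<in> gaps \<mu> r f"
  using assms by (auto simp: gaps_def image_iff)

text \<open>Adding 1 to both terms turns pairs with sum \<open>f\<close> into pairs with sum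
  \<open>f + 2\<close>. The pairs left over contain a gap anyway: 0 is paired with the top gap, and
  1 is a gap for \<open>Suc r\<close>.\<close>

lemma frobenius_pair_free_Suc:
  "frobenius_pair_free \<mu> (Suc r) (f + 2) \<longleftrightarrow> frobenius_pair_free \<mu> r f"
proof
  assume free: "frobenius_pair_free \<mu> (Suc r) (f + 2)"
  show "frobenius_pair_free \<mu> r f"
    unfolding frobenius_pair_free_def
  proof (intro allI impI)
    fix s t assume st: "s + t = f"
    show "s \<in> gaps \<mu> r f \<or> t \<in> gaps \<mu> r f"
    proof (cases "s = 0 \<or> t = 0")
      case True
      then show ?thesis using st by (auto simp: gaps_def)
    next
      case False
      have "Suc s + Suc t = f + 2" using st by simp
      then have "Suc s \<in> gaps \<mu> (Suc r) (f + 2) \<or> Suc t \<in> gaps \<mu> (Suc r) (f + 2)"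
        using free unfolding frobenius_pair_free_def by blast
      then show ?thesis
        using Suc_in_gaps_Suc_iff[of s f] Suc_in_gaps_Suc_iff[of t f] False st by auto
    qed
  qed
next
  assume free: "frobenius_pair_free \<mu> r f"
  show "frobenius_pair_free \<mu> (Suc r) (f + 2)"
    unfolding frobenius_pair_free_def
  proof (intro allI impI)
    fix s t assume st: "s + t = f + 2"
    show "s \<in> gaps \<mu> (Suc r) (f + 2) \<or> t \<in> gaps \<mu> (Suc r) (f + 2)"
    proof (cases "s \<le> 1 \<or> t \<le> 1")
      case True
      then have "s = 0 \<or> s = 1 \<or> t = 0 \<or> t = 1" by linarith
      then show ?thesis using st by (auto simp: gaps_def)
    next
      case False
      then obtain s' t' where eq: "s = Suc s'" "t = Suc t'" and pos: "0 < s'" "0 < t'"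
        by (metis One_nat_def Suc_le_mono bot_nat_0.not_eq_extremum le0 not0_implies_Suc order_refl)
      then have "s' + t' = f" using st by simp
      then have "s' \<in> gaps \<mu> r f \<or> t' \<in> gaps \<mu> r f"
        using free unfolding frobenius_pair_free_def by blast
      then show ?thesis
        using Suc_in_gaps_Suc_iff[of s' f] Suc_in_gaps_Suc_iff[of t' f] eq pos \<open>s' + t' = f\<close> by auto
    qed
  qed
qed

text \<open>For \<open>r = 0\<close> all gaps except \<open>f\<close> are at most
  \<open>corner \<mu>\<close>, so \<open>corner \<mu> + 1\<close> and its complement to
  \<open>f\<close> are both non-gaps.\<close>

lemma frobenius_pair_free_imp_pos:
  assumes part: "is_partition \<mu> k" and f: "3 * k + 3 \<le> f" and free: "frobenius_pair_free \<mu> r f"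
  shows "0 < r"
proof (rule ccontr)
  assume "\<not> 0 < r"
  \<comment> \<open>\<open>corner_le\<close> alone would need \<open>2 * k + 4 \<le> f\<close>,
    which may fail for \<open>k = 0\<close>; but then \<open>\<mu>\<close> is empty.\<close>
  have "corner \<mu> = 0 \<or> 0 < k"
    using part by (cases \<mu>) (auto simp: corner_def is_partition_def)
  then have le: "2 * corner \<mu> + 2 \<le> f"
    using corner_le[OF part] f by linarith
  have "corner \<mu> + 1 + (f - (corner \<mu> + 1)) = f"
    using le by linarith
  then have "corner \<mu> + 1 \<in> gaps \<mu> r f \<or> f - (corner \<mu> + 1) \<in> gaps \<mu> r f"
    using free unfolding frobenius_pair_free_def by blast
  then show False
    using gaps_le[OF part, of "corner \<mu> + 1" r f] gaps_le[OF part, of "f - (corner \<mu> + 1)" r f]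
      le \<open>\<not> 0 < r\<close> by linarith
qed

text \<open>Positive non-gaps exceed \<open>r\<close>, so two of them add up to at least
  \<open>2 * r + 2 = 2 * (f - corner \<mu>)\<close>, which is greater than \<open>f\<close> because
  \<open>corner \<mu> \<le> k + 1\<close>.\<close>

lemma frobenius_pair_free_extremal:
  assumes part: "is_partition \<mu> k" and f: "3 * k + 3 \<le> f" and r: "r + corner \<mu> + 1 = f"
  shows "frobenius_pair_free \<mu> r f"
  unfolding frobenius_pair_free_def
proof (intro allI impI, rule ccontr)
  fix s t assume st: "s + t = f" and nin: "\<not> (s \<in> gaps \<mu> r f \<or> t \<in> gaps \<mu> r f)"
  have "f \<in> gaps \<mu> r f" by (simp add: gaps_def)
  then have "0 < s" "0 < t" using st nin by (auto intro: gr0I)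
  then have "r < s" "r < t" using nin notin_gaps_gt by blast+
  then show False using st r f corner_le[OF part] by linarith
qed

section \<open>Parametrisation by the partition below the first row and column\<close>

text \<open>The inequality makes the first row of the decoded partition nonempty and no shorter than
  the second.\<close>

definition codes :: "nat \<Rightarrow> nat \<Rightarrow> (nat list \<times> nat) set" where
  "codes k f = {(\<mu>, r). is_partition \<mu> k \<and> r + corner \<mu> + 1 \<le> f \<and> frobenius_pair_free \<mu> r f}"

text \<open>The first row is chosen so that, with \<open>r + length \<mu>\<close> rows below it, the
  hook of cell (1,1) is \<open>f\<close>.\<close>

definition decode :: "nat \<Rightarrow> nat list \<times> nat \<Rightarrow> nat list" where
  "decode f = (\<lambda>(\<mu>, r). (f - r - length \<mu>) # map Suc \<mu> @ replicate r 1)"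

lemma sorted_pos_decompose:
  assumes "sorted_wrt (\<ge>) xs" "\<forall>x\<in>set xs. 0 < (x::nat)"
  obtains \<mu> r where "xs = map Suc \<mu> @ replicate r 1" "sorted_wrt (\<ge>) \<mu>" "\<forall>x\<in>set \<mu>. 0 < x"
proof -
  have "\<exists>\<mu> r. xs = map Suc \<mu> @ replicate r 1 \<and> sorted_wrt (\<ge>) \<mu> \<and> (\<forall>x\<in>set \<mu>. 0 < x)"
    using assms
  proof (induction xs)
    case (Cons x xs)
    have "sorted_wrt (\<ge>) xs" "\<forall>x\<in>set xs. 0 < x"
      using Cons.prems by auto
    then obtain \<mu> r where IH: "xs = map Suc \<mu> @ replicate r 1" "sorted_wrt (\<ge>) \<mu>" "\<forall>x\<in>set \<mu>. 0 < x"
      using Cons.IH by blast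
    show ?case
    proof (cases "x = 1")
      case True
      \<comment> \<open>A part 1 at the front of a nonincreasing list leaves no room for a part of
        at least 2.\<close>
      have "\<mu> = []"
      proof (rule ccontr)
        assume "\<mu> \<noteq> []"
        then obtain y where "y \<in> set \<mu>" by (cases \<mu>) auto
        then have "Suc y \<in> set xs" "0 < y" using IH by auto
        then show False using Cons.prems(1) True by auto
      qed
      then have "x # xs = map Suc [] @ replicate (Suc r) 1" using IH True by simp
      then show ?thesis by (metis empty_iff list.set(1) sorted_wrt.simps(1))
    next
      case False
      then obtain y where y: "x = Suc y" "0 < y" using Cons.prems by (cases x) auto
      have "x # xs = map Suc (y # \<mu>) @ replicate r 1"
        using IH(1) y by simp
      moreover have "z \<le> y" if "z \<in> set \<mu>" for z
      proof -
        have "Suc z \<in> set xs" using that IH(1) by simp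
        then show ?thesis using Cons.prems(1) y by auto
      qed
      then have "sorted_wrt (\<ge>) (y # \<mu>)"
        using IH(2) by simp
      moreover have "\<forall>z\<in>set (y # \<mu>). 0 < z"
        using IH(3) y by simp
      ultimately show ?thesis by blast
    qed
  qed auto
  then show thesis using that by blast
qed

text \<open>The parts greater than 1 determine \<open>\<mu>\<close>, and the length then determines
  \<open>r\<close>.\<close>

lemma map_Suc_append_replicate_inj:
  assumes "map Suc \<mu> @ replicate r 1 = map Suc \<nu> @ replicate s 1"
    and "\<forall>x\<in>set \<mu>. 0 < x" "\<forall>x\<in>set \<nu>. 0 < x"
  shows "\<mu> = \<nu> \<and> r = s"
proof -
  have filter: "filter (\<lambda>x. 1 < x) (map Suc \<kappa> @ replicate q 1) = map Suc \<kappa>"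
    if "\<forall>x\<in>set \<kappa>. 0 < x" for \<kappa> q
    using that by (simp add: filter_map o_def)
  have "map Suc \<mu> = map Suc \<nu>"
    using filter[OF assms(2), of r] filter[OF assms(3), of s] assms(1) by metis
  then have "\<mu> = \<nu>" by (simp add: inj_map_eq_map)
  with arg_cong[OF assms(1), of length] show ?thesis by simp
qed

lemma sum_list_map_Suc: "sum_list (map Suc xs) = sum_list xs + length xs"
  by (induction xs) auto

lemma length_le_corner: "length \<mu> \<le> corner \<mu>"
  by (cases \<mu>) (auto simp: corner_def)

text \<open>The hook of cell (1,1) takes \<open>f\<close> of the \<open>n\<close> cells; the other
  \<open>k\<close> cells form \<open>\<mu>\<close>.\<close>

lemma bij_betw_decode:
  assumes n: "n = f + k" and f: "3 * k < f"
  shows "bij_betw (decode f) (codes k f)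
    {l. is_partition l n \<and> hook_length l 1 1 = f \<and> numerical_semigroup (partition_set l)}"
    (is "bij_betw _ _ ?A")
  unfolding bij_betw_def
proof (intro conjI subset_antisym subsetI)
  show "inj_on (decode f) (codes k f)"
    by (rule inj_onI)
      (auto simp: codes_def decode_def is_partition_def dest: map_Suc_append_replicate_inj[simplified])
next
  fix l assume "l \<in> decode f ` codes k f"
  then obtain \<mu> r where l: "l = (f - r - length \<mu>) # map Suc \<mu> @ replicate r 1"
    and part: "is_partition \<mu> k" and r: "r + corner \<mu> + 1 \<le> f" and free: "frobenius_pair_free \<mu> r f"
    by (auto simp: codes_def decode_def)
  have len: "r + length \<mu> + 1 \<le> f"
    using r length_le_corner[of \<mu>] by linarith
  have pos: "\<forall>x\<in>set l. 0 < x"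
    using len by (auto simp: l)
  have "Suc x \<le> f - r - length \<mu>" if "x \<in> set \<mu>" for x
  proof -
    have "x + length \<mu> \<le> corner \<mu>"
      using part that by (cases \<mu>) (auto simp: is_partition_def corner_def)
    then show ?thesis using r by linarith
  qed
  moreover have "sorted_wrt (\<ge>) (replicate r (1::nat))"
    by (simp add: sorted_wrt_iff_nth_less)
  ultimately have "sorted_wrt (\<ge>) l"
    using part len by (auto simp: l is_partition_def sorted_wrt_append sorted_wrt_map)
  moreover have "sum_list l = n"
    using part len n by (simp add: l is_partition_def sum_list_map_Suc sum_list_replicate)
  moreover have "hook_length l 1 1 = f"
    using hook_length_Cons[OF pos[unfolded l]] len by (simp add: l)
  moreover have "hook_set l = gaps \<mu> r f"
    unfolding l gaps_def hook_set.simps hook_set_append_replicate using len by simp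
  then have "numerical_semigroup (partition_set l)"
    using numerical_semigroup_iff_frobenius_pair_free[OF part f] r free
      partition_set_conv_hook_set[OF pos] by simp
  ultimately show "l \<in> ?A"
    using pos by (simp add: is_partition_def)
next
  fix l assume "l \<in> ?A"
  then have sorted: "sorted_wrt (\<ge>) l" and pos: "\<forall>x\<in>set l. 0 < x" and sum: "sum_list l = n"
    and hook: "hook_length l 1 1 = f" and sg: "numerical_semigroup (partition_set l)"
    by (auto simp: is_partition_def)
  have "l \<noteq> []"
    using sum n f by auto
  then obtain x xs where l: "l = x # xs" by (cases l) auto
  have "sorted_wrt (\<ge>) xs" "\<forall>x\<in>set xs. 0 < x"
    using sorted pos by (simp_all add: l)
  then obtain \<mu> r where xs: "xs = map Suc \<mu> @ replicate r 1"
    and \<mu>: "sorted_wrt (\<ge>) \<mu>" "\<forall>x\<in>set \<mu>. 0 < x"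
    by (rule sorted_pos_decompose)
  have x: "x + r + length \<mu> = f"
    using hook_length_Cons[OF pos[unfolded l]] hook by (simp add: l xs)
  have part: "is_partition \<mu> k"
    using sum x n \<mu> by (simp add: l xs is_partition_def sum_list_map_Suc sum_list_replicate)
  have "r + corner \<mu> + 1 \<le> f"
  proof (cases \<mu>)
    case Nil
    then show ?thesis using pos x by (simp add: l corner_def)
  next
    case (Cons y \<nu>)
    then have "Suc y \<le> x" using sorted by (simp add: l xs)
    then show ?thesis using Cons x by (simp add: corner_def)
  qed
  moreover have "hook_set l = gaps \<mu> r f"
    unfolding l xs gaps_def hook_set.simps hook_set_append_replicate using x by (simp add: ac_simps)
  then have "numerical_semigroup (- gaps \<mu> r f)"
    using sg partition_set_conv_hook_set[OF pos] by simp
  ultimately have "(\<mu>, r) \<in> codes k f"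
    using numerical_semigroup_iff_frobenius_pair_free[OF part f] part by (simp add: codes_def)
  moreover have "decode f (\<mu>, r) = l"
    using x by (simp add: decode_def l xs)
  ultimately show "l \<in> decode f ` codes k f" by force
qed

section \<open>Counting codes: the passage from \<open>f\<close> to \<open>f + 2\<close>\<close>

lemma PF_eq_card_codes:
  assumes "3 * k < f"
  shows "PF (f + k) f = card (codes k f)"
  unfolding PF_def using bij_betw_same_card[OF bij_betw_decode[OF refl assms]] by simp

lemma finite_codes: "finite (codes k f)"
  by (rule finite_subset[of _ "{l. is_partition l k} \<times> {..f}"])
    (auto simp: codes_def finite_partitions)

lemma codes_add_2:
  assumes f: "3 * k + 1 \<le> f"
  shows "codes k (f + 2) = map_prod id Suc ` codes k f
    \<union> (\<lambda>\<mu>. (\<mu>, f + 1 - corner \<mu>)) ` {\<mu>. is_partition \<mu> k}" (is "_ = ?A \<union> ?B")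
proof (intro subset_antisym subsetI)
  fix p assume "p \<in> codes k (f + 2)"
  then obtain \<mu> r where p: "p = (\<mu>, r)" and part: "is_partition \<mu> k"
    and r: "r + corner \<mu> + 1 \<le> f + 2" and free: "frobenius_pair_free \<mu> r (f + 2)"
    by (auto simp: codes_def)
  show "p \<in> ?A \<union> ?B"
  proof (cases "r + corner \<mu> = f + 1")
    case True
    then have "r = f + 1 - corner \<mu>" by linarith
    then show ?thesis using p part by auto
  next
    case False
    obtain r' where r': "r = Suc r'"
      using frobenius_pair_free_imp_pos[OF part _ free] f by (cases r) auto
    then have "(\<mu>, r') \<in> codes k f"
      using r False part free frobenius_pair_free_Suc by (simp add: codes_def)
    then show ?thesis unfolding p r' by force
  qed
next
  fix p assume "p \<in> ?A \<union> ?B"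
  then show "p \<in> codes k (f + 2)"
  proof
    assume "p \<in> ?A"
    then show ?thesis
      using frobenius_pair_free_Suc by (auto simp: codes_def)
  next
    assume "p \<in> ?B"
    then obtain \<mu> where p: "p = (\<mu>, f + 1 - corner \<mu>)" and part: "is_partition \<mu> k" by auto
    \<comment> \<open>The subtraction is not truncated, since
      \<open>corner \<mu> \<le> k + 1 \<le> f + 1\<close>.\<close>
    have "f + 1 - corner \<mu> + corner \<mu> + 1 = f + 2"
      using corner_le[OF part] f by linarith
    moreover from this have "frobenius_pair_free \<mu> (f + 1 - corner \<mu>) (f + 2)"
      using frobenius_pair_free_extremal[OF part] f by simp
    ultimately show ?thesis using p part by (simp add: codes_def)
  qed
qed

lemma card_codes_add_2:
  assumes "3 * k + 1 \<le> f"
  shows "card (codes k (f + 2)) = card (codes k f) + num_partitions k"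
proof -
  let ?g = "\<lambda>\<mu>. (\<mu>, f + 1 - corner \<mu>)"
  \<comment> \<open>A shifted code satisfies \<open>Suc r + corner \<mu> \<le> f\<close>, whereas in
    the second set the corresponding sum is at least \<open>f + 1\<close>.\<close>
  have "map_prod id Suc ` codes k f \<inter> ?g ` {\<mu>. is_partition \<mu> k} = {}"
    by (auto simp: codes_def)
  moreover have "inj_on (map_prod id Suc) (codes k f)" "inj_on ?g {\<mu>. is_partition \<mu> k}"
    by (auto simp: inj_on_def)
  ultimately show ?thesis
    unfolding codes_add_2[OF assms]
    by (subst card_Un_disjoint)
      (simp_all add: finite_codes finite_partitions card_image num_partitions_def)
qed

theorem theorem4p4:
  fixes k n :: nat
  assumes "n \<ge> 4 * k + 3"
  shows "int (PF n (n - k)) - int (PF (n - 2) (n - k - 2)) = int (num_partitions k)"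
proof -
  \<comment> \<open>With \<open>f\<close> the smaller of the two hook lengths,
    \<open>4 * k + 3 \<le> n\<close> becomes \<open>3 * k + 1 \<le> f\<close>, so both counts are in
    the range \<open>3 * k < f\<close>.\<close>
  obtain f where n: "n = f + 2 + k" and f: "3 * k + 1 \<le> f"
    using assms that[of "n - k - 2"] by simp
  have "PF n (n - k) = card (codes k (f + 2))"
    using PF_eq_card_codes[of k "f + 2"] f by (simp add: n)
  moreover have "PF (n - 2) (n - k - 2) = card (codes k f)"
    using PF_eq_card_codes[of k f] f by (simp add: n)
  ultimately show ?thesis
    using card_codes_add_2[OF f] by simp
qed

end
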